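(* Let $M$ be a positive integer, let $D\subseteq\mathbb{R}^2$ be the unit disk, and let $f:D\to\mathbb{R}$ be a linear combination of Zernike polynomials of degree at most $M-1$, that is, $$f(r,\theta)=\sum_{i,j,\ell}\alpha_{i,j}^\ell\,\overline Z_{i,j}^\ell(r,\theta),$$ where $\alpha_{i,j}^\ell\in\mathbb{R}$, the sum is over nonnegative integers $i,j$ satisfying $i+2j\le M-1$, and over $\ell\in\{0,1\}$ when $i\geq 1$ and a single value of $\ell$ when $i=0$ (since $\overline Z_{0,j}^0=\overline Z_{0,j}^1$). Let $r_1,\dots,r_M$ be the $M$ roots of $\widetilde P_M$, let $\omega_1,\dots,\omega_M$ be the corresponding Gaussian quadrature weights, and let $\theta_l=l\frac{2\pi}{2M-1}$ for $l=1,2,\dots,2M-1$. Then for all indices $(i,j,\ell)$ appearing in the sum, $$\alpha_{i,j}^\ell=\sum_{k=1}^M\left[\overline R_{i,j}(r_k)\,\omega_k\sum_{l=1}^{2M-1}\frac{2\pi}{2M-1}f(r_k,\theta_l)\,S_i^\ell(\theta_l)\right].$$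
   Context: For $\ell\in\{0,1\}$ and a nonnegative integer $N$, the function $S_N^\ell:\mathbb{R}\to\mathbb{R}$ is defined by $S_0^\ell(\theta)=(2\pi)^{-1/2}$, and for $N>0$, $S_N^0(\theta)=\sin(N\theta)/\sqrt{\pi}$ and $S_N^1(\theta)=\cos(N\theta)/\sqrt{\pi}$. For nonnegative integers $N,n$ the radial polynomial $R_{N,n}$, of degree $N+2n$, is $$R_{N,n}(x)=x^N\sum_{k=0}^n(-1)^k\binom{n+N}{k}\binom{n}{k}(x^2)^{n-k}(1-x^2)^k,\qquad 0\le x\le 1,$$ and $\overline R_{N,n}(x)=\sqrt{2(2n+N+1)}\,R_{N,n}(x)$. The normalized Zernike polynomial is $\overline Z_{N,n}^\ell(r,\theta)=\overline R_{N,n}(r)S_N^\ell(\theta)$, where $(r,\theta)$ are polar coordinates on the unit disk; it has degree $N+2n$. Functions on $D$ are written in polar coordinates. For a nonnegative integer $n$, $\widetilde P_n:[0,1]\to\mathbb{R}$ is the shifted Jacobi polynomial $\widetilde P_n(x)=\sqrt{2n+2}\,P_n^{(1,0)}(1-2x)$, where $P_n^{(\alpha,\beta)}$ is the Jacobi polynomial of degree $n$ with standard normalization (orthogonal on $(-1,1)$ with respect to $(1-x)^\alpha(1+x)^\beta$). The $\widetilde P_n$ are orthonormal on $[0,1]$ with respect to the weight $w(x)=x$. The Gaussian quadrature weights $\omega_1,\dots,\omega_M$ associated with the nodes $r_1,\dots,r_M$ are the unique solution of the linear system $\sum_{k=1}^M\omega_k\widetilde P_j(r_k)=\int_0^1\widetilde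 P_j(x)\,x\,dx$, $j=0,1,\dots,M-1$. *)

theory Defs
  imports "HOL-Analysis.Analysis"
begin

text \<open>Functions on the unit disk are functions on \<^typ>\<open>real ^ 2\<close>, evaluated at
  \<open>polar r \<theta>\<close> for \<open>0 \<le> r \<le> 1\<close>.\<close>

definition polar :: "real \<Rightarrow> real \<Rightarrow> real ^ 2" where
  "polar r \<theta> = vector [r * cos \<theta>, r * sin \<theta>]"

text \<open>The superscript \<open>l\<close> ranges over \<open>{0, 1}\<close>; the value for other \<open>l\<close> is junk.\<close>

definition S :: "nat \<Rightarrow> nat \<Rightarrow> real \<Rightarrow> real" where
  "S l N \<theta> = (if N = 0 then (2 * pi) powr (- 1 / 2)
              else if l = 0 then sin (real N * \<theta>) / sqrt pi
              else cos (real N * \<theta>) / sqrt pi)"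

definition zernike_radial :: "nat \<Rightarrow> nat \<Rightarrow> real \<Rightarrow> real" where
  "zernike_radial N n x =
     x ^ N * (\<Sum>k=0..n. (- 1) ^ k * real ((n + N) choose k) * real (n choose k)
                          * (x\<^sup>2) ^ (n - k) * (1 - x\<^sup>2) ^ k)"

definition normalized_radial :: "nat \<Rightarrow> nat \<Rightarrow> real \<Rightarrow> real" where
  "normalized_radial N n x = sqrt (2 * real (2 * n + N + 1)) * zernike_radial N n x"

definition zernike :: "nat \<Rightarrow> nat \<Rightarrow> nat \<Rightarrow> real \<Rightarrow> real \<Rightarrow> real" where
  "zernike l N n r \<theta> = normalized_radial N n r * S l N \<theta>"

text \<open>The indices \<open>(i, j, l)\<close> of the Zernike polynomials of degree at most \<open>M - 1\<close>. As the case
  \<open>i = 0\<close> does not depend on \<open>l\<close>, it is listed for one value \<open>l0\<close> only.\<close>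

definition zernike_indices :: "nat \<Rightarrow> nat \<Rightarrow> (nat \<times> nat \<times> nat) set" where
  "zernike_indices l0 M =
     {(i, j, l). i + 2 * j \<le> M - 1 \<and> l \<in> {0, 1} \<and> (i = 0 \<longrightarrow> l = l0)}"

text \<open>The explicit form (4.3.2) in Szego's \<^emph>\<open>Orthogonal Polynomials\<close>, which has the standard
  normalization: the value at \<open>1\<close> is \<open>(n + \<alpha>) gchoose n\<close>.\<close>

definition jacobi :: "real \<Rightarrow> real \<Rightarrow> nat \<Rightarrow> real \<Rightarrow> real" where
  "jacobi \<alpha> \<beta> n x =
     (\<Sum>s=0..n. ((real n + \<alpha>) gchoose (n - s)) * ((real n + \<beta>) gchoose s)
                  * ((x - 1) / 2) ^ s * ((x + 1) / 2) ^ (n - s))"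

definition shifted_jacobi :: "nat \<Rightarrow> real \<Rightarrow> real" where
  "shifted_jacobi n x = sqrt (2 * real n + 2) * jacobi 1 0 n (1 - 2 * x)"

definition gaussian_weights :: "nat \<Rightarrow> (nat \<Rightarrow> real) \<Rightarrow> (nat \<Rightarrow> real) \<Rightarrow> bool" where
  "gaussian_weights M r \<omega> \<longleftrightarrow>
     (\<forall>j<M. (\<Sum>k=1..M. \<omega> k * shifted_jacobi j (r k))
              = integral {0..1} (\<lambda>x. shifted_jacobi j x * x))"

end

theory Submission
  imports Defs
begin

text \<open>
  The formula holds because the quadrature rule with nodes \<open>(r\<^sub>k, \<theta>\<^sub>m)\<close> and weights
  \<open>\<omega>\<^sub>k * 2\<pi> / (2M - 1)\<close> integrates exactly the product of any two of the Zernike polynomials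
  that occur. These are orthonormal on the disk, so they are orthonormal for the discrete inner
  product too, and multiplying \<open>f\<close> by one of them and summing over the nodes isolates its
  coefficient. Since the rule is a product rule, the two variables separate.

  In the angle, a product of two of the functions \<open>S\<close> of frequencies \<open>i, i' \<le> M - 1\<close> is a
  combination of phase-shifted cosines of frequencies \<open>i - i'\<close> and \<open>i + i'\<close>, both smaller than \<open>2M - 1\<close> in
  absolute value. The sum of such a wave over \<open>2M - 1\<close> equispaced points is a geometric sum of a
  root of unity and vanishes unless the frequency is \<open>0\<close> (\<open>sum_cos_equispaced\<close>). This yields
  \<open>discrete_angular_orthogonality\<close>, which kills all terms of \<open>f\<close> except those with the
  given \<open>i\<close> and \<open>l\<close>.

  In the radius, only products of \<open>R\<^bsub>i,j\<^esub>\<close> and \<open>R\<^bsub>i,j'\<^esub>\<close> with the same \<open>i\<close> remain.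
  Their degree is at most \<open>2M - 2\<close>, and Gaussian quadrature is exact up to degree \<open>2M - 1\<close>
  (\<open>gaussian_quadrature\<close>), so that \<open>discrete_radial_orthogonality\<close> follows from the
  orthogonality of the radial polynomials with respect to \<open>x dx\<close>.

  Both facts on radial integrals are instances of one orthogonality relation. Let
  \<open>Q\<^bsub>a,n\<^esub>\<close> be the Jacobi polynomial for the weight \<open>t\<^sup>a\<close> on \<open>[0,1]\<close>. The polynomial whose
  roots are the nodes is a multiple of \<open>Q\<^bsub>1,M\<^esub>\<close>, and
  \<open>R\<^bsub>N,n\<^esub>(x) = \<plusminus> x\<^sup>N Q\<^bsub>N,n\<^esub>(x\<^sup>2)\<close>, so the substitution \<open>t = x\<^sup>2\<close> turns
  \<open>\<integral> R\<^bsub>N,n\<^esub> R\<^bsub>N,m\<^esub> x dx\<close> into half of \<open>\<integral> Q\<^bsub>N,n\<^esub> Q\<^bsub>N,m\<^esub> t\<^sup>N dt\<close>. The relation itself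
  (\<open>jacobi_poly_orthogonality\<close>) comes from expanding the moments of \<open>Q\<^bsub>a,n\<^esub>\<close> in Beta
  integrals, which turns them into \<open>n\<close>-th finite differences of polynomials of degree at most
  \<open>n\<close>.
\<close>

section \<open>Integrals of polynomials over the unit interval\<close>

definition unit_integral :: "real poly \<Rightarrow> real" where
  "unit_integral p = integral {0..1} (poly p)"

lemma poly_integrable [simp]: "poly p integrable_on {0..1::real}"
  by (intro integrable_continuous_real continuous_intros)

lemma unit_integral_add: "unit_integral (p + q) = unit_integral p + unit_integral q"
proof -
  have "poly (p + q) = (\<lambda>x. poly p x + poly q x)" by auto
  then show ?thesis by (simp add: unit_integral_def integral_add)
qed

lemma unit_integral_smult: "unit_integral (smult c p) = c * unit_integral p"
proof -
  have "poly (smult c p) = (\<lambda>x. c * poly p x)" by auto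
  then show ?thesis by (simp add: unit_integral_def)
qed

lemma unit_integral_0 [simp]: "unit_integral 0 = 0"
  using unit_integral_smult[of 0 0] by simp

lemma unit_integral_sum: "unit_integral (\<Sum>i\<in>A. g i) = (\<Sum>i\<in>A. unit_integral (g i))"
  by (induction A rule: infinite_finite_induct) (auto simp: unit_integral_add)

lemma unit_integral_pderiv: "unit_integral (pderiv p) = poly p 1 - poly p 0"
proof -
  have "(poly (pderiv p) has_integral poly p 1 - poly p 0) {0..1}"
    by (rule fundamental_theorem_of_calculus)
       (auto intro!: DERIV_subset[OF poly_DERIV] simp flip: has_real_derivative_iff_has_vector_derivative)
  then show ?thesis by (simp add: unit_integral_def integral_unique)
qed

text \<open>The substitution \<open>t = x\<^sup>2\<close>, which links the radial variable to the argument of the Jacobi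
  polynomials.\<close>

lemma unit_integral_substitute_square:
  "unit_integral (monom 1 1 * pcompose p (monom 1 2)) = unit_integral p / 2"
proof -
  define q where "q = (\<Sum>i\<le>degree p. monom (coeff p i / real (Suc i)) (Suc i))"
  have "pderiv (\<Sum>i\<in>A. g i) = (\<Sum>i\<in>A. pderiv (g i))" for A :: "nat set" and g :: "nat \<Rightarrow> real poly"
    by (induction A rule: infinite_finite_induct) (auto simp: pderiv_add)
  then have q: "pderiv q = p"
    by (simp add: q_def pderiv_monom poly_as_sum_of_monoms del: of_nat_Suc)
  have "monom 1 1 * pcompose p (monom 1 2) = smult (1 / 2) (pderiv (pcompose q (monom 1 2)))"
    by (simp add: pderiv_pcompose q pderiv_monom mult.commute smult_monom flip: mult_smult_left)
  then show ?thesis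
    by (simp add: unit_integral_smult unit_integral_pderiv flip: q)
       (simp add: poly_pcompose poly_monom)
qed

lemma unit_integral_monom: "unit_integral (monom 1 m) = 1 / real (m + 1)"
proof -
  have "monom (1::real) m = pderiv (smult (1 / real (m + 1)) (monom 1 (Suc m)))"
    by (simp add: pderiv_smult pderiv_monom smult_monom)
  then show ?thesis
    by (simp only: unit_integral_pderiv) (simp add: poly_monom)
qed

text \<open>Integration by parts moves one factor at a time from \<open>(1 - t)\<^sup>q\<close> to \<open>t\<^sup>p\<close>: the boundary terms
  of \<open>t\<^bsup>p+1\<^esup>(1 - t)\<^bsup>q+1\<^esup>\<close> vanish.\<close>

lemma beta_integral:
  "unit_integral (monom 1 p * [:1, - 1:] ^ q) = fact p * fact q / fact (p + q + 1)"
proof (induction q arbitrary: p)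
  case 0
  then show ?case by (simp add: unit_integral_monom)
next
  case (Suc q)
  define F :: "real poly" where "F = monom 1 (Suc p) * [:1, - 1:] ^ Suc q"
  have "pderiv F = smult (real (p + 1)) (monom 1 p * [:1, - 1:] ^ Suc q)
          - smult (real (q + 1)) (monom 1 (Suc p) * [:1, - 1:] ^ q)"
    unfolding F_def pderiv_mult pderiv_power_Suc
    by (simp add: pderiv_monom pderiv_pCons mult.commute algebra_simps del: power_Suc)
       (simp flip: mult_smult_left add: smult_monom del: power_Suc)
  moreover have "unit_integral (pderiv F) = 0"
    unfolding unit_integral_pderiv by (simp add: F_def poly_monom)
  ultimately have "real (p + 1) * unit_integral (monom 1 p * [:1, - 1:] ^ Suc q)
      = real (q + 1) * unit_integral (monom 1 (Suc p) * [:1, - 1:] ^ q)"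
    using unit_integral_add[of "pderiv F" "smult (real (q + 1)) (monom 1 (Suc p) * [:1, - 1:] ^ q)"]
    by (simp add: unit_integral_smult del: power_Suc)
  also have "\<dots> = real (p + 1) * (fact p * fact (Suc q) / fact (p + Suc q + 1))"
    unfolding Suc.IH by simp
  finally show ?case
    by (simp only: mult_cancel_left) simp
qed

section \<open>Orthogonality of the Jacobi polynomials with weight \<open>t\<^sup>a\<close>\<close>

text \<open>
  This is \<open>P\<^sub>n\<^bsup>(a,0)\<^esup>(1 - 2t)\<close>. The expansion in products \<open>t\<^sup>s(1 - t)\<^bsup>n-s\<^esup>\<close>, rather than in powers
  of \<open>t\<close>, makes every moment a sum of Beta integrals.
\<close>

definition jacobi_poly :: "nat \<Rightarrow> nat \<Rightarrow> real poly" where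
  "jacobi_poly a n =
     (\<Sum>s=0..n. smult ((- 1) ^ s * real ((n + a) choose (n - s)) * real (n choose s))
                 (monom 1 s * [:1, - 1:] ^ (n - s)))"

text \<open>
  Up to the sign \<open>(- 1)\<^sup>n\<close>, this is the \<open>n\<close>-th finite difference at \<open>0\<close> of
  \<open>s \<mapsto> (b + s) choose m\<close>. By Pascal's rule, each difference lowers \<open>m\<close> by one.
\<close>

lemma alternating_binomial_sum:
  assumes "m \<le> n"
  shows "(\<Sum>s=0..n. (- 1) ^ s * real (n choose s) * real ((b + s) choose m))
    = (if m = n then (- 1) ^ n else 0)"
  using assms
proof (induction n arbitrary: m b)
  case 0
  then show ?case by simp
next
  case (Suc n)
  have rec: "(\<Sum>s=0..Suc n. (- 1) ^ s * real (Suc n choose s) * g s)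
      = (\<Sum>s=0..n. (- 1) ^ s * real (n choose s) * (g s - g (Suc s)))" for g :: "nat \<Rightarrow> real"
  proof -
    have "(\<Sum>s=0..Suc n. (- 1) ^ s * real (Suc n choose s) * g s)
       = g 0 + (\<Sum>s=0..n. (- 1) ^ Suc s * real (Suc n choose Suc s) * g (Suc s))"
      by (subst sum.atLeast0_atMost_Suc_shift) simp
    also have "\<dots> = g 0 + (\<Sum>s=0..n. (- 1) ^ Suc s * real (n choose Suc s) * g (Suc s))
        - (\<Sum>s=0..n. (- 1) ^ s * real (n choose s) * g (Suc s))"
    proof -
      have "(- 1) ^ Suc s * real (Suc n choose Suc s) * g (Suc s)
          = (- 1) ^ Suc s * real (n choose Suc s) * g (Suc s)
            - (- 1) ^ s * real (n choose s) * g (Suc s)" for s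
        by (simp add: algebra_simps)
      then show ?thesis by (simp only: sum_subtractf add_diff_eq)
    qed
    also have "g 0 + (\<Sum>s=0..n. (- 1) ^ Suc s * real (n choose Suc s) * g (Suc s))
        = (\<Sum>s=0..Suc n. (- 1) ^ s * real (n choose s) * g s)"
      by (subst sum.atLeast0_atMost_Suc_shift) simp
    also have "\<dots> = (\<Sum>s=0..n. (- 1) ^ s * real (n choose s) * g s)" by simp
    finally show ?thesis by (simp add: algebra_simps sum_subtractf)
  qed
  show ?case
  proof (cases m)
    case 0
    then show ?thesis unfolding rec by simp
  next
    case (Suc k)
    have "real ((b + s) choose m) - real ((b + Suc s) choose m) = - real ((b + s) choose k)" for s
      using Suc by simp
    then show ?thesis unfolding rec using Suc.IH[of k b] Suc.prems Suc
      by (simp add: sum_negf)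
  qed
qed

text \<open>
  In the Beta integral of the \<open>s\<close>-th summand the factor \<open>(n - s)!\<close> cancels against the first
  binomial coefficient, and what depends on \<open>s\<close> is \<open>(- 1)\<^sup>s (n choose s)\<close> times
  \<open>(a + m + s)! / (a + s)!\<close>, a multiple of \<open>(a + m + s) choose m\<close>. So the moment is an
  alternating binomial sum.
\<close>

lemma jacobi_poly_moment:
  assumes "m \<le> n"
  shows "unit_integral (monom 1 (a + m) * jacobi_poly a n)
    = (if m = n then (- 1) ^ n * fact (n + a) * fact n / fact (2 * n + a + 1) else 0)"
proof -
  have "unit_integral (monom 1 (a + m) * jacobi_poly a n)
      = (\<Sum>s=0..n. (- 1) ^ s * real ((n + a) choose (n - s)) * real (n choose s)
          * (fact (a + m + s) * fact (n - s) / fact (n + m + a + 1)))"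
  proof -
    have "monom 1 (a + m) * jacobi_poly a n
       = (\<Sum>s=0..n. smult ((- 1) ^ s * real ((n + a) choose (n - s)) * real (n choose s))
                 (monom 1 (a + m + s) * [:1, - 1:] ^ (n - s)))"
      unfolding jacobi_poly_def sum_distrib_left
      by (intro sum.cong refl) (simp add: mult_monom flip: mult.assoc)
    then show ?thesis
      by (simp add: unit_integral_sum unit_integral_smult beta_integral)
         (intro sum.cong refl, simp add: add_ac)
  qed
  also have "\<dots> = (\<Sum>s=0..n. fact (n + a) * fact m / fact (n + m + a + 1)
          * ((- 1) ^ s * real (n choose s) * real ((a + m + s) choose m)))"
  proof (intro sum.cong refl)
    fix s assume s: "s \<in> {0..n}"
    have 1: "real ((n + a) choose (n - s)) = fact (n + a) / (fact (n - s) * fact (a + s))"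
      using s binomial_fact[of "n - s" "n + a", where 'a = real] by (simp add: add.commute)
    have 2: "real ((a + m + s) choose m) = fact (a + m + s) / (fact m * fact (a + s))"
      using binomial_fact[of m "a + m + s", where 'a = real] by simp
    show "(- 1) ^ s * real ((n + a) choose (n - s)) * real (n choose s)
          * (fact (a + m + s) * fact (n - s) / fact (n + m + a + 1))
       = fact (n + a) * fact m / fact (n + m + a + 1)
          * ((- 1) ^ s * real (n choose s) * real ((a + m + s) choose m))"
      unfolding 1 2 by (simp add: field_simps)
  qed
  also have "\<dots> = fact (n + a) * fact m / fact (n + m + a + 1) * (if m = n then (- 1) ^ n else 0)"
    unfolding sum_distrib_left[symmetric] alternating_binomial_sum[OF assms] ..
  finally show ?thesis
    by (cases "m = n") (simp_all only: mult_2 mult_2_right mult_ac times_divide_eq_right times_divide_eq_left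
          if_True if_False mult_zero_right mult_zero_left refl)
qed

lemma degree_jacobi_poly_le: "degree (jacobi_poly a n) \<le> n"
proof -
  have "degree (monom 1 s * [:1, - 1 :: real:] ^ (n - s)) \<le> n" if "s \<le> n" for s
    using that degree_mult_le[of "monom 1 s" "[:1, - 1 :: real:] ^ (n - s)"]
    by (simp add: degree_power_eq degree_monom_eq)
  then show ?thesis unfolding jacobi_poly_def
    by (intro degree_sum_le) (auto intro: order_trans[OF degree_smult_le])
qed

text \<open>The summands all have the same sign at the top degree, so the coefficient is given by
  Vandermonde's identity.\<close>

lemma coeff_jacobi_poly: "coeff (jacobi_poly a n) n = (- 1) ^ n * real ((2 * n + a) choose n)"
proof -
  have top: "coeff (monom 1 s * [:1, - 1 :: real:] ^ (n - s)) n = (- 1) ^ (n - s)" if "s \<le> n" for s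
    using lead_coeff_power[of "[:1, - 1 :: real:]" "n - s"] that
    by (simp add: coeff_monom_mult degree_power_eq)
  have "coeff (jacobi_poly a n) n
      = (\<Sum>s=0..n. (- 1) ^ n * (real (n choose s) * real ((n + a) choose (n - s))))"
    unfolding jacobi_poly_def coeff_sum
    by (intro sum.cong refl) (auto simp: top mult_ac simp flip: power_add)
  also have "\<dots> = (- 1) ^ n * real (\<Sum>s\<le>n. (n choose s) * ((n + a) choose (n - s)))"
    by (simp add: sum_distrib_left atLeast0AtMost)
  also have "(\<Sum>s\<le>n. (n choose s) * ((n + a) choose (n - s))) = (2 * n + a) choose n"
    using vandermonde[of n "n + a" n] by (simp add: mult_2 add.assoc)
  finally show ?thesis .
qed

lemma coeff_jacobi_poly_nonzero: "coeff (jacobi_poly a n) n \<noteq> 0"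
  by (simp add: coeff_jacobi_poly)

lemma degree_jacobi_poly: "degree (jacobi_poly a n) = n"
  using degree_jacobi_poly_le le_degree[OF coeff_jacobi_poly_nonzero] by (rule antisym)

text \<open>Besides the orthogonality to all lower degrees, this contains the value needed for the norm:
  only the top coefficient of \<open>p\<close> matters.\<close>

lemma jacobi_poly_orthogonal:
  assumes "degree p \<le> n"
  shows "unit_integral (monom 1 a * (jacobi_poly a n * p))
    = coeff p n * ((- 1) ^ n * fact (n + a) * fact n / fact (2 * n + a + 1))"
proof -
  have "p = (\<Sum>i\<le>n. monom (coeff p i) i)"
    using poly_as_sum_of_monoms'[OF assms] by simp
  then have "monom 1 a * (jacobi_poly a n * p)
      = monom 1 a * (jacobi_poly a n * (\<Sum>i\<le>n. monom (coeff p i) i))" by simp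
  also have "\<dots> = (\<Sum>i\<le>n. smult (coeff p i) (monom 1 (a + i) * jacobi_poly a n))"
    unfolding sum_distrib_left
  proof (intro sum.cong refl)
    fix i
    have "monom (coeff p i) i = smult (coeff p i) (monom 1 i)" by (simp add: smult_monom)
    moreover have "monom (1::real) (a + i) = monom 1 a * monom 1 i" by (simp add: mult_monom)
    ultimately show "monom 1 a * (jacobi_poly a n * monom (coeff p i) i)
        = smult (coeff p i) (monom 1 (a + i) * jacobi_poly a n)"
      by (simp add: mult_ac)
  qed
  finally show ?thesis
    by (simp add: unit_integral_sum unit_integral_smult jacobi_poly_moment if_distrib
             cong: if_cong)
qed

lemma jacobi_poly_orthogonality:
  "unit_integral (monom 1 a * (jacobi_poly a n * jacobi_poly a m))
    = (if n = m then 1 / real (2 * n + a + 1) else 0)"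
proof -
  have less: "unit_integral (monom 1 a * (jacobi_poly a n * jacobi_poly a m)) = 0" if "m < n" for m n
    using that jacobi_poly_orthogonal[of "jacobi_poly a m" n a]
    by (simp add: degree_jacobi_poly coeff_eq_0)
  have "unit_integral (monom 1 a * (jacobi_poly a n * jacobi_poly a n)) = 1 / real (2 * n + a + 1)"
  proof -
    define N where "N = 2 * n + a"
    have "real (N choose n) = fact N / (fact n * fact (n + a))"
      using binomial_fact[of n N, where 'a = real] by (simp add: N_def)
    then have binom: "real (N choose n) * (fact (n + a) * fact n) = fact N"
      by simp
    have sign: "(- 1 :: real) ^ n * (- 1) ^ n = 1" by (simp flip: power_add mult_2)
    have "unit_integral (monom 1 a * (jacobi_poly a n * jacobi_poly a n))
        = ((- 1) ^ n * real (N choose n)) * ((- 1) ^ n * fact (n + a) * fact n / fact (N + 1))"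
      using jacobi_poly_orthogonal[of "jacobi_poly a n" n a]
      by (simp only: degree_jacobi_poly coeff_jacobi_poly N_def le_refl simp_thms)
    also have "\<dots> = ((- 1) ^ n * (- 1) ^ n) * (real (N choose n) * (fact (n + a) * fact n)) / fact (N + 1)"
      by (simp only: mult_ac times_divide_eq_right times_divide_eq_left)
    also have "\<dots> = fact N / (real (N + 1) * fact N)"
      unfolding sign binom by simp
    finally show ?thesis by (simp add: N_def)
  qed
  then show ?thesis
    using less[of m n] less[of n m] by (cases n m rule: linorder_cases) (simp_all add: mult.commute)
qed


section \<open>Nodes and radial polynomials in terms of Jacobi polynomials\<close>

lemma shifted_jacobi_eq: "shifted_jacobi n x = sqrt (2 * real n + 2) * poly (jacobi_poly 1 n) x"
proof -
  have "jacobi 1 0 n (1 - 2 * x) = poly (jacobi_poly 1 n) x"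
    unfolding jacobi_def jacobi_poly_def poly_sum
  proof (intro sum.cong refl)
    fix s
    have 1: "(real n + 1) gchoose (n - s) = real ((n + 1) choose (n - s))"
      by (simp add: binomial_gbinomial add.commute)
    have 2: "(real n + 0) gchoose s = real (n choose s)"
      by (simp add: binomial_gbinomial)
    have 3: "(1 - 2 * x - 1) / 2 = - x" "(1 - 2 * x + 1) / 2 = 1 - x"
      by simp_all
    show "((real n + 1) gchoose (n - s)) * ((real n + 0) gchoose s)
        * ((1 - 2 * x - 1) / 2) ^ s * ((1 - 2 * x + 1) / 2) ^ (n - s)
      = poly (smult ((- 1) ^ s * real ((n + 1) choose (n - s)) * real (n choose s))
              (monom 1 s * [:1, - 1:] ^ (n - s))) x"
      unfolding 1 2 3 by (simp add: poly_monom power_minus[of x])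
  qed
  then show ?thesis by (simp add: shifted_jacobi_def)
qed

text \<open>Reversing the order of summation exchanges the roles of \<open>x\<^sup>2\<close> and \<open>1 - x\<^sup>2\<close>, which produces the
  sign.\<close>

lemma zernike_radial_eq:
  "zernike_radial N n x = (- 1) ^ n * x ^ N * poly (jacobi_poly N n) (x\<^sup>2)"
proof -
  have "(\<Sum>k=0..n. (- 1) ^ k * real ((n + N) choose k) * real (n choose k)
            * (x\<^sup>2) ^ (n - k) * (1 - x\<^sup>2) ^ k)
      = (\<Sum>s=0..n. (- 1) ^ (n - s) * real ((n + N) choose (n - s)) * real (n choose (n - s))
            * (x\<^sup>2) ^ (n - (n - s)) * (1 - x\<^sup>2) ^ (n - s))"
    by (rule sum.atLeastAtMost_rev[of _ 0 n, simplified])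
  also have "\<dots> = (- 1) ^ n * poly (jacobi_poly N n) (x\<^sup>2)"
    unfolding jacobi_poly_def poly_sum sum_distrib_left
  proof (intro sum.cong refl)
    fix s assume s: "s \<in> {0..n}"
    then have "(- 1 :: real) ^ (n - s) = (- 1) ^ n * (- 1) ^ s"
      by (simp add: minus_one_power_iff)
    then show "(- 1) ^ (n - s) * real ((n + N) choose (n - s)) * real (n choose (n - s))
            * (x\<^sup>2) ^ (n - (n - s)) * (1 - x\<^sup>2) ^ (n - s)
        = (- 1) ^ n * poly (smult ((- 1) ^ s * real ((n + N) choose (n - s)) * real (n choose s))
              (monom 1 s * [:1, - 1:] ^ (n - s))) (x\<^sup>2)"
      using s by (simp add: poly_monom binomial_symmetric[of s n])
  qed
  finally show ?thesis by (simp add: zernike_radial_def)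
qed

section \<open>Exactness of Gaussian quadrature\<close>

text \<open>Polynomials \<open>q\<^sub>j\<close> of exact degree \<open>j < M\<close> span those of degree below \<open>M\<close>. The bound on the
  degree of \<open>p\<close> is expressed by vanishing coefficients so that \<open>M = 0\<close>, which forces \<open>p = 0\<close>,
  can start the induction.\<close>

lemma linear_functional_eqI:
  fixes E :: "real poly \<Rightarrow> real" and q :: "nat \<Rightarrow> real poly"
  assumes add: "\<And>p p'. E (p + p') = E p + E p'"
    and smult: "\<And>c p. E (smult c p) = c * E p"
    and q: "\<And>j. j < M \<Longrightarrow> degree (q j) \<le> j" "\<And>j. j < M \<Longrightarrow> coeff (q j) j \<noteq> 0"
    and zero: "\<And>j. j < M \<Longrightarrow> E (q j) = 0"
    and p: "\<And>i. i \<ge> M \<Longrightarrow> coeff p i = 0"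
  shows "E p = 0"
proof -
  have "E p = 0" if "d \<le> M" "\<And>i. i \<ge> d \<Longrightarrow> coeff p i = 0" for d p
    using that
  proof (induction d arbitrary: p)
    case 0
    then have "p = 0" by (intro poly_eqI) simp
    then show ?case using smult[of 0 0] by simp
  next
    case (Suc d)
    \<comment> \<open>Subtracting this multiple of \<open>q d\<close> cancels the coefficient of \<open>p\<close> at \<open>d\<close>.\<close>
    define c where "c = coeff p d / coeff (q d) d"
    have "E (p - smult c (q d)) = 0"
    proof (rule Suc.IH)
      fix i assume "d \<le> i"
      show "coeff (p - smult c (q d)) i = 0"
      proof (cases "i = d")
        case True
        then show ?thesis using q(2)[of d] Suc.prems(1) by (simp add: c_def)
      next
        case False
        then have "degree (q d) < i" using q(1)[of d] Suc.prems(1) \<open>d \<le> i\<close> by simp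
        then show ?thesis using Suc.prems(2)[of i] False \<open>d \<le> i\<close> by (simp add: coeff_eq_0)
      qed
    qed (use Suc.prems in simp)
    then show ?case
      using add[of "p - smult c (q d)" "smult c (q d)"] smult[of c "q d"] zero[of d] Suc.prems(1)
      by simp
  qed
  then show ?thesis using p by blast
qed

text \<open>
  The weights are chosen so that the rule is exact below degree \<open>M\<close>. Dividing by the polynomial \<open>Q\<close>
  that vanishes at the nodes doubles the degree: for \<open>p = Q q + s\<close> with \<open>q\<close> and \<open>s\<close> of degree
  below \<open>M\<close>, the product \<open>Q q\<close> contributes nothing to the sum because \<open>Q\<close> is zero at the nodes,
  and nothing to the integral because \<open>Q\<close> is orthogonal to \<open>q\<close>.
\<close>

lemma gaussian_quadrature:
  assumes M: "M > 0"
    and roots: "\<And>k. k \<in> {1..M} \<Longrightarrow> shifted_jacobi M (r k) = 0"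
    and weights: "gaussian_weights M r \<omega>"
    and p: "degree p < 2 * M"
  shows "(\<Sum>k=1..M. \<omega> k * poly p (r k)) = unit_integral (monom 1 1 * p)"
proof -
  define Q where "Q = jacobi_poly 1 M"
  \<comment> \<open>The quadrature error.\<close>
  define E where "E p = (\<Sum>k=1..M. \<omega> k * poly p (r k)) - unit_integral (monom 1 1 * p)" for p
  have E_add: "E (p + p') = E p + E p'" for p p'
    by (simp add: E_def sum.distrib algebra_simps unit_integral_add)
  have E_smult: "E (smult c p) = c * E p" for c p
    by (simp add: E_def sum_distrib_left algebra_simps unit_integral_smult)
  have E_low: "E p = 0" if "degree p < M" for p
  proof (rule linear_functional_eqI[of E M "jacobi_poly 1" p])
    fix j assume "j < M"
    define c where "c = sqrt (2 * real j + 2)"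
    have "integral {0..1} (\<lambda>x. shifted_jacobi j x * x) = c * unit_integral (monom 1 1 * jacobi_poly 1 j)"
      unfolding unit_integral_def integral_mult_right[symmetric]
      by (intro integral_cong) (simp add: shifted_jacobi_eq c_def poly_monom)
    moreover have "(\<Sum>k=1..M. \<omega> k * shifted_jacobi j (r k))
        = c * (\<Sum>k=1..M. \<omega> k * poly (jacobi_poly 1 j) (r k))"
      unfolding sum_distrib_left
      by (intro sum.cong refl) (simp add: shifted_jacobi_eq c_def)
    moreover have "c \<noteq> 0" by (simp add: c_def add_nonneg_eq_0_iff)
    ultimately show "E (jacobi_poly 1 j) = 0"
      using weights \<open>j < M\<close> by (simp add: gaussian_weights_def E_def)
  qed (use that in \<open>auto simp: E_add E_smult degree_jacobi_poly coeff_jacobi_poly_nonzero intro: coeff_eq_0\<close>)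
  have Q: "degree Q = M" "Q \<noteq> 0"
    using M by (auto simp: Q_def degree_jacobi_poly dest: arg_cong[of _ _ degree])
  have mod: "degree (p mod Q) < M"
    using degree_mod_less[OF Q(2), of p] Q M by auto
  have div: "degree (p div Q) < M"
  proof (cases "p div Q = 0")
    case False
    have "degree (p div Q * Q) = degree (p - p mod Q)" by (simp add: minus_mod_eq_div_mult)
    also have "\<dots> < 2 * M" using p mod M by (intro degree_diff_less) auto
    finally show ?thesis using False Q by (simp add: degree_mult_eq)
  qed (use M in simp)
  have "poly Q (r k) = 0" if "k \<in> {1..M}" for k
    using roots[OF that] by (simp add: shifted_jacobi_eq Q_def add_nonneg_eq_0_iff)
  moreover have "unit_integral (monom 1 1 * (Q * (p div Q))) = 0"
    using jacobi_poly_orthogonal[of "p div Q" M 1] div by (simp add: Q_def coeff_eq_0)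
  ultimately have "E (Q * (p div Q)) = 0" by (simp add: E_def)
  then have "E p = 0"
    using E_add[of "Q * (p div Q)" "p mod Q"] E_low[OF mod] by simp
  then show ?thesis by (simp add: E_def)
qed

section \<open>Discrete orthogonality\<close>

text \<open>The product is even, namely a polynomial in \<open>x\<^sup>2\<close> of degree at most \<open>N + n + m < M\<close>, so the
  quadrature rule replaces the sum by an integral that \<open>t = x\<^sup>2\<close> turns into the one of the
  Jacobi polynomials.\<close>

lemma discrete_radial_orthogonality:
  assumes M: "M > 0"
    and roots: "\<And>k. k \<in> {1..M} \<Longrightarrow> shifted_jacobi M (r k) = 0"
    and weights: "gaussian_weights M r \<omega>"
    and deg: "N + n + m < M"
  shows "(\<Sum>k=1..M. \<omega> k * (normalized_radial N n (r k) * normalized_radial N m (r k)))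
    = (if n = m then 1 else 0)"
proof -
  define a where "a j = sqrt (2 * real (2 * j + N + 1)) * (- 1) ^ j" for j
  define q where "q = monom 1 N * (jacobi_poly N n * jacobi_poly N m)"
  define p where "p = pcompose q (monom 1 2)"
  have radial: "normalized_radial N j x = a j * (x ^ N * poly (jacobi_poly N j) (x\<^sup>2))" for j x
    by (simp add: normalized_radial_def zernike_radial_eq a_def)
  have nodes: "normalized_radial N n x * normalized_radial N m x = a n * a m * poly p x" for x
    unfolding radial p_def q_def
    by (simp add: poly_pcompose poly_monom power2_eq_square power_mult_distrib)
  have "degree q \<le> N + (n + m)"
    using degree_mult_le[of "monom 1 N" "jacobi_poly N n * jacobi_poly N m"]
      degree_mult_le[of "jacobi_poly N n" "jacobi_poly N m"]
    by (simp add: q_def degree_jacobi_poly degree_monom_eq)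
  then have "degree p < 2 * M"
    using deg by (simp add: p_def degree_pcompose degree_monom_eq)
  then have "(\<Sum>k=1..M. \<omega> k * poly p (r k)) = unit_integral (monom 1 1 * p)"
    using roots by (intro gaussian_quadrature M weights)
  also have "\<dots> = (if n = m then 1 / (2 * real (2 * n + N + 1)) else 0)"
    unfolding p_def unit_integral_substitute_square q_def jacobi_poly_orthogonality
    by (cases "n = m") (simp_all only: simp_thms if_True if_False divide_divide_eq_left mult.commute div_0)
  finally have sum: "(\<Sum>k=1..M. \<omega> k * poly p (r k)) = \<dots>" .
  have "(\<Sum>k=1..M. \<omega> k * (normalized_radial N n (r k) * normalized_radial N m (r k)))
      = a n * a m * (\<Sum>k=1..M. \<omega> k * poly p (r k))"
    unfolding nodes sum_distrib_left by (intro sum.cong refl) (simp add: mult_ac)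
  moreover have "a n * a n = 2 * real (2 * n + N + 1)"
  proof -
    have "(- 1 :: real) ^ n * (- 1) ^ n = 1" by (simp flip: power_add mult_2)
    moreover have "a n * a n
        = (sqrt (2 * real (2 * n + N + 1)))\<^sup>2 * ((- 1 :: real) ^ n * (- 1) ^ n)"
      unfolding a_def power2_eq_square by (simp only: mult_ac)
    ultimately show ?thesis by simp
  qed
  ultimately show ?thesis unfolding sum by auto
qed

text \<open>A geometric sum of powers of the root of unity \<open>e\<^bsup>2\<pi>ip/K\<^esup>\<close>, which differs from \<open>1\<close> since
  \<open>K\<close> does not divide \<open>p\<close>. The phase \<open>u\<close> covers cosines and sines at once.\<close>

lemma sum_cos_equispaced:
  fixes K :: nat and p :: int
  assumes "p \<noteq> 0" "\<bar>p\<bar> < int K"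
  shows "(\<Sum>m=1..K. cos (of_int p * (real m * (2 * pi / real K)) - u)) = 0"
proof -
  have K: "real K > 0" using assms by linarith
  define z where "z = cis (of_int p * (2 * pi / real K))"
  have "z ^ K = cis (2 * pi * of_int p)"
    using K by (simp add: z_def Complex.DeMoivre mult_ac)
  then have z1: "z ^ K = 1" by simp
  have "z \<noteq> 1"
  proof
    assume "z = 1"
    then have "cos (of_int p * (2 * pi / real K)) = 1" by (simp add: z_def complex_eq_iff)
    then obtain n :: int where "of_int p * (2 * pi / real K) = of_int n * 2 * pi"
      unfolding cos_one_2pi_int by blast
    then have "real_of_int p = of_int (n * int K)" using K by (simp add: field_simps)
    then have "p = n * int K" by (simp only: of_int_eq_iff)
    then show False using assms by (auto simp: abs_mult mult_less_cancel_right)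
  qed
  have "(\<Sum>m=1..K. z ^ m) = z * (\<Sum>m<K. z ^ m)"
    by (simp add: sum_distrib_left sum.atLeast1_atMost_eq)
  also have "\<dots> = 0" using geometric_sum[OF \<open>z \<noteq> 1\<close>, of K] z1 by simp
  finally have "Re (cis (- u) * (\<Sum>m=1..K. z ^ m)) = 0" by simp
  then have "(\<Sum>m=1..K. Re (cis (- u) * z ^ m)) = 0"
    by (simp only: sum_distrib_left Re_sum)
  moreover have "Re (cis (- u) * z ^ m) = cos (of_int p * (real m * (2 * pi / real K)) - u)" for m
  proof -
    have "cis (- u) * z ^ m = cis (of_int p * (real m * (2 * pi / real K)) - u)"
      by (simp add: z_def Complex.DeMoivre cis_mult algebra_simps)
    then show ?thesis by simp
  qed
  ultimately show ?thesis by simp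
qed

lemma S_eq_shifted_cos:
  assumes "N > 0"
  shows "S l N t = cos (real N * t - (if l = 0 then pi / 2 else 0)) / sqrt pi"
  using assms by (simp add: S_def cos_diff)

text \<open>
  Writing sines as shifted cosines, a product of two waves is half the sum of the waves with the
  difference and the sum of frequencies and phases. Suppose first that both frequencies are
  positive. The second wave always averages to \<open>0\<close>. The first one does so for \<open>i \<noteq> i'\<close>, and
  for \<open>i = i'\<close> it is constant, equal to the cosine of the difference of the phases, which is
  \<open>1\<close> or \<open>cos (\<plusminus> \<pi>/2) = 0\<close>. If just one frequency is \<open>0\<close>, the product is a single wave and
  averages to \<open>0\<close>. If both are \<open>0\<close>, the two functions are equal whatever \<open>l\<close> and \<open>l'\<close> are,
  hence the condition that \<open>l = l'\<close> in that case.
\<close>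

lemma discrete_angular_orthogonality:
  assumes K: "i + i' < K" and l: "l \<in> {0, 1}" "l' \<in> {0, 1}"
    and same: "i = 0 \<Longrightarrow> i' = 0 \<Longrightarrow> l = l'"
  shows "(\<Sum>m=1..K. 2 * pi / real K * S l i (real m * (2 * pi / real K)) * S l' i' (real m * (2 * pi / real K)))
    = (if i = i' \<and> l = l' then 1 else 0)"
proof -
  define h where "h = 2 * pi / real K"
  define u where "u l = (if l = 0 then pi / 2 else 0)" for l :: nat
  define c where "c = (2 * pi) powr (- 1 / 2)"
  have K0: "real K > 0" using K by simp
  have cc: "c * c = 1 / (2 * pi)"
    by (simp add: c_def powr_minus_divide flip: powr_add)
  have vanish: "(\<Sum>m=1..K. cos (of_int p * (real m * h) - v)) = 0"
    if "p \<noteq> 0" "\<bar>p\<bar> < int K" for p v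
    unfolding h_def using that by (rule sum_cos_equispaced)
  have const: "S l 0 t = c" for l t by (simp add: S_def c_def)
  have wave: "S l N t = cos (real N * t - u l) / sqrt pi" if "N > 0" for l N t
    using that by (simp add: S_eq_shifted_cos u_def)
  have mixed: "(\<Sum>m=1..K. h * S l N (real m * h) * S l' 0 (real m * h)) = 0"
    if "0 < N" "N < K" for l l' N
  proof -
    have "(\<Sum>m=1..K. h * S l N (real m * h) * S l' 0 (real m * h))
        = h * c / sqrt pi * (\<Sum>m=1..K. cos (of_int (int N) * (real m * h) - u l))"
      unfolding sum_distrib_left using that by (intro sum.cong refl) (simp add: const wave)
    then show ?thesis using vanish[of "int N" "u l"] that by simp
  qed
  consider "i = 0" "i' = 0" | "i = 0" "i' > 0" | "i > 0" "i' = 0" | "i > 0" "i' > 0" by blast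
  then have "(\<Sum>m=1..K. h * S l i (real m * h) * S l' i' (real m * h))
      = (if i = i' \<and> l = l' then 1 else 0)"
  proof cases
    case 1
    then show ?thesis using same K0 by (simp add: const mult.assoc cc) (simp add: h_def)
  next
    case 2
    then show ?thesis using mixed[of i' l' l] K by (simp add: mult_ac)
  next
    case 3
    then show ?thesis using mixed[of i l l'] K by simp
  next
    case 4
    have "h * S l i (real m * h) * S l' i' (real m * h)
        = h / (2 * pi) * (cos (of_int (int i - int i') * (real m * h) - (u l - u l'))
            + cos (of_int (int i + int i') * (real m * h) - (u l + u l')))" for m
    proof -
      define x y where "x = real i * (real m * h) - u l" and "y = real i' * (real m * h) - u l'"
      have "h * S l i (real m * h) * S l' i' (real m * h) = h / pi * (cos x * cos y)"
        using 4 by (simp add: wave x_def y_def)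
      also have "\<dots> = h / (2 * pi) * (cos (x - y) + cos (x + y))"
        by (simp add: cos_times_cos)
      also have "x - y = of_int (int i - int i') * (real m * h) - (u l - u l')"
        by (simp add: x_def y_def algebra_simps)
      also have "x + y = of_int (int i + int i') * (real m * h) - (u l + u l')"
        by (simp add: x_def y_def algebra_simps)
      finally show ?thesis .
    qed
    then have "(\<Sum>m=1..K. h * S l i (real m * h) * S l' i' (real m * h))
        = h / (2 * pi) * ((\<Sum>m=1..K. cos (of_int (int i - int i') * (real m * h) - (u l - u l')))
           + (\<Sum>m=1..K. cos (of_int (int i + int i') * (real m * h) - (u l + u l'))))"
      by (simp only: sum.distrib flip: sum_distrib_left)
    also have "(\<Sum>m=1..K. cos (of_int (int i + int i') * (real m * h) - (u l + u l'))) = 0"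
      using 4 K by (intro vanish) auto
    also have "h / (2 * pi) * ((\<Sum>m=1..K. cos (of_int (int i - int i') * (real m * h) - (u l - u l'))) + 0)
        = (if i = i' \<and> l = l' then 1 else 0)"
    proof (cases "i = i'")
      case True
      then show ?thesis using K0 l by (auto simp: h_def u_def)
    next
      case False
      then show ?thesis using vanish[of "int i - int i'" "u l - u l'"] 4 K by simp
    qed
    finally show ?thesis .
  qed
  then show ?thesis by (simp only: h_def)
qed

section \<open>Recovering the coefficients\<close>

lemma finite_zernike_indices: "finite (zernike_indices l0 M)"
  by (rule finite_subset[of _ "{..M} \<times> {..M} \<times> {0, 1}"]) (auto simp: zernike_indices_def)

theorem theorem5p1:
  fixes M l0 :: nat
    and f :: "real ^ 2 \<Rightarrow> real"
    and \<alpha> :: "nat \<Rightarrow> nat \<Rightarrow> nat \<Rightarrow> real"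
    and r \<omega> \<theta> :: "nat \<Rightarrow> real"
  assumes "M > 0"
    and "l0 \<in> {0, 1}"
    and "\<And>\<rho> t. 0 \<le> \<rho> \<Longrightarrow> \<rho> \<le> 1 \<Longrightarrow>
           f (polar \<rho> t) = (\<Sum>(i, j, l)\<in>zernike_indices l0 M. \<alpha> i j l * zernike l i j \<rho> t)"
    and "bij_betw r {1..M} {x \<in> {0..1}. shifted_jacobi M x = 0}"
    and "gaussian_weights M r \<omega>"
    and "\<And>m. m \<in> {1..2 * M - 1} \<Longrightarrow> \<theta> m = real m * (2 * pi / real (2 * M - 1))"
    and "(i, j, l) \<in> zernike_indices l0 M"
  shows "\<alpha> i j l =
    (\<Sum>k=1..M. normalized_radial i j (r k) * \<omega> k *
       (\<Sum>m=1..2 * M - 1. 2 * pi / real (2 * M - 1) * f (polar (r k) (\<theta> m)) * S l i (\<theta> m)))"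
proof -
  define K where "K = 2 * M - 1"
  define I where "I = zernike_indices l0 M"
  define \<tau> where "\<tau> m = real m * (2 * pi / real K)" for m
  have roots: "r k \<in> {0..1}" "shifted_jacobi M (r k) = 0" if "k \<in> {1..M}" for k
    using bij_betwE[OF assms(4)] that by auto
  \<comment> \<open>On the circle of radius \<open>r k\<close>, the discrete Fourier sum keeps the terms of \<open>f\<close> with the
    angular part of \<open>(i, j, l)\<close>.\<close>
  have angular: "(\<Sum>m=1..K. 2 * pi / real K * f (polar (r k) (\<theta> m)) * S l i (\<theta> m))
      = (\<Sum>(i', j', l')\<in>I. if i' = i \<and> l' = l then \<alpha> i' j' l' * normalized_radial i' j' (r k) else 0)"
    if k: "k \<in> {1..M}" for k
  proof -
    have "(\<Sum>m=1..K. 2 * pi / real K * f (polar (r k) (\<theta> m)) * S l i (\<theta> m))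
        = (\<Sum>m=1..K. \<Sum>(i', j', l')\<in>I. \<alpha> i' j' l' * normalized_radial i' j' (r k)
            * (2 * pi / real K * S l' i' (\<tau> m) * S l i (\<tau> m)))"
      using roots(1)[OF k] assms(3,6)
      by (intro sum.cong refl)
         (auto simp: I_def K_def \<tau>_def zernike_def sum_distrib_left sum_distrib_right split_def mult_ac)
    also have "\<dots> = (\<Sum>(i', j', l')\<in>I. \<alpha> i' j' l' * normalized_radial i' j' (r k)
            * (\<Sum>m=1..K. 2 * pi / real K * S l' i' (\<tau> m) * S l i (\<tau> m)))"
      by (subst sum.swap) (simp add: split_def sum_distrib_left)
    also have "\<dots> = (\<Sum>(i', j', l')\<in>I.
        if i' = i \<and> l' = l then \<alpha> i' j' l' * normalized_radial i' j' (r k) else 0)"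
    proof (rule sum.cong[OF refl], clarify)
      fix i' j' l' assume "(i', j', l') \<in> I"
      then have "(\<Sum>m=1..K. 2 * pi / real K * S l' i' (\<tau> m) * S l i (\<tau> m))
          = (if i' = i \<and> l' = l then 1 else 0)"
        unfolding \<tau>_def using assms(1,7)
        by (intro discrete_angular_orthogonality) (auto simp: I_def K_def zernike_indices_def)
      then show "\<alpha> i' j' l' * normalized_radial i' j' (r k)
            * (\<Sum>m=1..K. 2 * pi / real K * S l' i' (\<tau> m) * S l i (\<tau> m))
          = (if i' = i \<and> l' = l then \<alpha> i' j' l' * normalized_radial i' j' (r k) else 0)"
        by simp
    qed
    finally show ?thesis .
  qed
  have "(\<Sum>k=1..M. normalized_radial i j (r k) * \<omega> k *
       (\<Sum>m=1..K. 2 * pi / real K * f (polar (r k) (\<theta> m)) * S l i (\<theta> m)))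
     = (\<Sum>k=1..M. \<Sum>(i', j', l')\<in>I. if i' = i \<and> l' = l then \<alpha> i' j' l' *
          (\<omega> k * (normalized_radial i j (r k) * normalized_radial i' j' (r k))) else 0)"
    by (intro sum.cong refl, subst angular)
       (auto simp: sum_distrib_left split_def intro!: sum.cong)
  also have "\<dots> = (\<Sum>(i', j', l')\<in>I. if i' = i \<and> l' = l then \<alpha> i' j' l' *
          (\<Sum>k=1..M. \<omega> k * (normalized_radial i j (r k) * normalized_radial i' j' (r k))) else 0)"
    by (subst sum.swap) (auto simp: sum_distrib_left split_def intro!: sum.cong)
  \<comment> \<open>Among these, the radial quadrature keeps the one with \<open>j' = j\<close>.\<close>
  also have "\<dots> = (\<Sum>x\<in>I. if x = (i, j, l) then \<alpha> i j l else 0)"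
  proof (rule sum.cong[OF refl], clarify)
    fix i' j' l' assume mem: "(i', j', l') \<in> I"
    have "(\<Sum>k=1..M. \<omega> k * (normalized_radial i j (r k) * normalized_radial i j' (r k)))
        = (if j = j' then 1 else 0)" if "i' = i"
      using mem that assms(1,5,7) roots(2)
      by (intro discrete_radial_orthogonality) (auto simp: I_def zernike_indices_def)
    then show "(if i' = i \<and> l' = l then \<alpha> i' j' l' *
          (\<Sum>k=1..M. \<omega> k * (normalized_radial i j (r k) * normalized_radial i' j' (r k))) else 0)
        = (if (i', j', l') = (i, j, l) then \<alpha> i j l else 0)"
      by auto
  qed
  also have "\<dots> = \<alpha> i j l"
    using assms(7) by (simp add: I_def finite_zernike_indices)
  finally show ?thesis by (simp add: K_def)
qed

end
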